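(* For every $n\geq 1$, let $M_e(n)$ be the number of (distinct, not necessarily inequivalent) even self-dual $L$-codes of length $n$. Then $$M_e(n)=\sum_{[C]}\frac{2^n\cdot n!}{|\mathrm{Aut}(C)|}=\prod_{i=0}^{n-1}(2^i+1),$$ where the sum runs over the equivalence classes $[C]$ of even self-dual $L$-codes of length $n$.
   Context: Let $L=\{0,1,\omega,\bar\omega\}$ be the Klein four-group $\mathbf{Z}_2\times\mathbf{Z}_2$. Define $|0|^2=0$, $|1|^2=1$, $|\omega|^2=|\bar\omega|^2=2$ and $q(x)=|x|^2 \bmod 2$. The dot product on $L$ is $x\cdot y=q(x+y)-q(x)-q(y)\in\mathbf{F}_2$; explicitly $x\cdot y=1$ iff $x,y$ are distinct and both nonzero. On $L^n$ the scalar product is $(\mathbf{x},\mathbf{y})=\sum_i x_i\cdot y_i$ and the Euclidean weight is $\mathrm{ewt}(\mathbf{x})=\sum_i|x_i|^2$. An $L$-code of length $n$ is a subgroup $C\subseteq L^n$; $C^\perp=\{\mathbf{x}:(\mathbf{x},\mathbf{y})=0\ \forall\mathbf{y}\in C\}$; $C$ is self-dual if $C=C^\perp$ and even if $\mathrm{ewt}(\mathbf{x})$ is even for every $\mathbf{x}\in C$. The group $G=S_2^n{:}S_n$ (order $2^n n!$) acts on $L^n$ by permuting coordinates and independently interchanging $\omega,\bar\omega$ in each coordinate; codes in the same $G$-orbit are equivalent, and $\mathrm{Aut}(C)=\{g\in G:gC=C\}$. *)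

theory Defs
  imports "HOL-Algebra.Algebra" "HOL-Combinatorics.Permutations" "HOL-Library.Z2"
begin

datatype klein = K0 | K1 | Omega | OmegaBar

instantiation klein :: ab_group_add
begin

definition zero_klein :: klein where "0 = K0"

fun plus_klein :: "klein \<Rightarrow> klein \<Rightarrow> klein" where
  "K0 + y = y"
| "x + K0 = x"
| "K1 + K1 = K0"
| "K1 + Omega = OmegaBar"
| "K1 + OmegaBar = Omega"
| "Omega + K1 = OmegaBar"
| "Omega + Omega = K0"
| "Omega + OmegaBar = K1"
| "OmegaBar + K1 = Omega"
| "OmegaBar + Omega = K1"
| "OmegaBar + OmegaBar = K0"

definition uminus_klein :: "klein \<Rightarrow> klein" where "- x = (x :: klein)"

definition minus_klein :: "klein \<Rightarrow> klein \<Rightarrow> klein" where "x - y = x + (y :: klein)"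

instance
proof
  fix a b c :: klein
  show "a + b + c = a + (b + c)" by (cases a; cases b; cases c) simp_all
  show "a + b = b + a" by (cases a; cases b) simp_all
  show "0 + a = a" by (simp add: zero_klein_def)
  show "- a + a = 0" by (cases a) (simp_all add: zero_klein_def uminus_klein_def)
  show "a - b = a + - b" by (simp add: minus_klein_def uminus_klein_def)
qed

end

fun sqnorm :: "klein \<Rightarrow> nat" where
  "sqnorm K0 = 0"
| "sqnorm K1 = 1"
| "sqnorm Omega = 2"
| "sqnorm OmegaBar = 2"

definition qform :: "klein \<Rightarrow> bit" where
  "qform x = of_nat (sqnorm x)"

definition kdot :: "klein \<Rightarrow> klein \<Rightarrow> bit" where
  "kdot x y = qform (x + y) - qform x - qform y"

lemma kdot_eq_1_iff: "kdot x y = 1 \<longleftrightarrow> x \<noteq> y \<and> x \<noteq> 0 \<and> y \<noteq> 0"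
  by (cases x; cases y) (simp_all add: kdot_def qform_def zero_klein_def)

text \<open>
  A vector of length \<open>n\<close> is a function on \<open>nat\<close> with coordinates indexed by
  \<open>{..<n}\<close> and padded by \<open>0\<close>, so that distinct vectors are distinct functions.
\<close>

definition Lpow :: "nat \<Rightarrow> (nat \<Rightarrow> klein) monoid" where
  "Lpow n = \<lparr>carrier = {x. \<forall>i\<ge>n. x i = 0},
             monoid.mult = (\<lambda>x y i. x i + y i),
             one = (\<lambda>i. 0)\<rparr>"

definition scalar_prod :: "nat \<Rightarrow> (nat \<Rightarrow> klein) \<Rightarrow> (nat \<Rightarrow> klein) \<Rightarrow> bit" where
  "scalar_prod n x y = (\<Sum>i<n. kdot (x i) (y i))"

definition ewt :: "nat \<Rightarrow> (nat \<Rightarrow> klein) \<Rightarrow> nat" where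
  "ewt n x = (\<Sum>i<n. sqnorm (x i))"

definition L_code :: "nat \<Rightarrow> (nat \<Rightarrow> klein) set \<Rightarrow> bool" where
  "L_code n C \<longleftrightarrow> subgroup C (Lpow n)"

definition dual_code :: "nat \<Rightarrow> (nat \<Rightarrow> klein) set \<Rightarrow> (nat \<Rightarrow> klein) set" where
  "dual_code n C = {x \<in> carrier (Lpow n). \<forall>y\<in>C. scalar_prod n x y = 0}"

definition self_dual :: "nat \<Rightarrow> (nat \<Rightarrow> klein) set \<Rightarrow> bool" where
  "self_dual n C \<longleftrightarrow> C = dual_code n C"

definition even_code :: "nat \<Rightarrow> (nat \<Rightarrow> klein) set \<Rightarrow> bool" where
  "even_code n C \<longleftrightarrow> (\<forall>x\<in>C. even (ewt n x))"

definition even_self_dual_codes :: "nat \<Rightarrow> (nat \<Rightarrow> klein) set set" where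
  "even_self_dual_codes n = {C. L_code n C \<and> self_dual n C \<and> even_code n C}"

definition M_e :: "nat \<Rightarrow> nat" where
  "M_e n = card (even_self_dual_codes n)"

fun kconj :: "klein \<Rightarrow> klein" where
  "kconj K0 = K0"
| "kconj K1 = K1"
| "kconj Omega = OmegaBar"
| "kconj OmegaBar = Omega"

text \<open>
  An element of the semidirect product \<open>S\<^sub>2\<^sup>n : S\<^sub>n\<close> is a pair \<open>(S, p)\<close>: first the
  coordinates are permuted by \<open>p\<close> (the entry at \<open>i\<close> moves to \<open>p i\<close>), then
  \<open>Omega\<close> and \<open>OmegaBar\<close> are interchanged in the coordinates belonging to \<open>S\<close>.
\<close>

definition coord_group :: "nat \<Rightarrow> (nat set \<times> (nat \<Rightarrow> nat)) monoid" where
  "coord_group n = \<lparr>carrier = {S. S \<subseteq> {..<n}} \<times> {p. p permutes {..<n}},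
           monoid.mult = (\<lambda>(S, p) (T, r). (sym_diff S (p ` T), p \<circ> r)),
           one = ({}, id)\<rparr>"

definition act :: "nat set \<times> (nat \<Rightarrow> nat) \<Rightarrow> (nat \<Rightarrow> klein) \<Rightarrow> (nat \<Rightarrow> klein)" where
  "act = (\<lambda>(S, p) x i. if i \<in> S then kconj (x (inv_into UNIV p i)) else x (inv_into UNIV p i))"

definition code_act :: "nat set \<times> (nat \<Rightarrow> nat) \<Rightarrow> (nat \<Rightarrow> klein) set \<Rightarrow> (nat \<Rightarrow> klein) set" where
  "code_act g C = act g ` C"

definition Aut :: "nat \<Rightarrow> (nat \<Rightarrow> klein) set \<Rightarrow> (nat set \<times> (nat \<Rightarrow> nat)) set" where
  "Aut n C = stabilizer (coord_group n) code_act C"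

definition code_classes :: "nat \<Rightarrow> (nat \<Rightarrow> klein) set set set" where
  "code_classes n = orbits (coord_group n) (even_self_dual_codes n) code_act"

lemma card_coord_group: "card (carrier (coord_group n)) = 2 ^ n * fact n"
proof -
  have "card {p. p permutes {..<n}} = fact n"
    by (rule card_permutations) simp_all
  then show ?thesis
    by (simp add: coord_group_def card_cartesian_product card_Pow flip: Pow_def)
qed

lemma act_mult:
  assumes "g \<in> carrier (coord_group n)" "h \<in> carrier (coord_group n)"
  shows "act (g \<otimes>\<^bsub>coord_group n\<^esub> h) x = act g (act h x)"
proof -
  obtain S p T r where g: "g = (S, p)" and h: "h = (T, r)" by fastforce
  have p: "bij p" and r: "bij r"
    using assms by (auto simp: g h coord_group_def intro: permutes_bij)
  have k: "kconj (kconj y) = y" for y by (cases y) simp_all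
  have "i \<in> p ` T \<longleftrightarrow> inv_into UNIV p i \<in> T" for i
    using p by (metis bij_image_Collect_eq bij_inv_eq_iff imageE image_eqI)
  moreover have "inv_into UNIV (p \<circ> r) i = inv_into UNIV r (inv_into UNIV p i)" for i
    using o_inv_distrib[OF p r] by simp
  ultimately show ?thesis
    by (auto simp: g h coord_group_def act_def k fun_eq_iff)
qed

lemma group_coord_group: "group (coord_group n)"
proof (rule groupI)
  fix g h k
  assume g: "g \<in> carrier (coord_group n)" and h: "h \<in> carrier (coord_group n)"
  obtain S p T r where gh [simp]: "g = (S, p)" "h = (T, r)" by fastforce
  have p: "p permutes {..<n}" and r: "r permutes {..<n}" and "S \<subseteq> {..<n}" "T \<subseteq> {..<n}"
    using g h by (auto simp: coord_group_def)
  moreover have "p ` T \<subseteq> {..<n}"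
    using \<open>T \<subseteq> {..<n}\<close> permutes_image[OF p] by blast
  ultimately show "g \<otimes>\<^bsub>coord_group n\<^esub> h \<in> carrier (coord_group n)"
    using permutes_compose[OF r p] by (auto simp: coord_group_def)
  assume k: "k \<in> carrier (coord_group n)"
  obtain U s where [simp]: "k = (U, s)" by fastforce
  have "p ` (sym_diff T (r ` U)) = sym_diff (p ` T) (p ` r ` U)"
    using permutes_inj[OF p] by (simp add: image_set_diff image_Un)
  then show "g \<otimes>\<^bsub>coord_group n\<^esub> h \<otimes>\<^bsub>coord_group n\<^esub> k = g \<otimes>\<^bsub>coord_group n\<^esub> (h \<otimes>\<^bsub>coord_group n\<^esub> k)"
    by (auto simp: coord_group_def comp_assoc image_comp[symmetric])
next
  show "\<one>\<^bsub>coord_group n\<^esub> \<in> carrier (coord_group n)" by (simp add: coord_group_def permutes_id)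
next
  fix g assume g: "g \<in> carrier (coord_group n)"
  then show "\<one>\<^bsub>coord_group n\<^esub> \<otimes>\<^bsub>coord_group n\<^esub> g = g" by (auto simp: coord_group_def)
  obtain S p where [simp]: "g = (S, p)" by fastforce
  have p: "p permutes {..<n}" and S: "S \<subseteq> {..<n}" using g by (auto simp: coord_group_def)
  have "inv_into UNIV p ` S \<subseteq> {..<n}"
    using S permutes_image[OF permutes_inv[OF p]] by blast
  then have "(inv_into UNIV p ` S, inv_into UNIV p) \<in> carrier (coord_group n)"
    using permutes_inv[OF p] by (simp add: coord_group_def)
  moreover have "(inv_into UNIV p ` S, inv_into UNIV p) \<otimes>\<^bsub>coord_group n\<^esub> g = \<one>\<^bsub>coord_group n\<^esub>"
    using permutes_inv_o(2)[OF p] by (simp add: coord_group_def)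
  ultimately show "\<exists>h\<in>carrier (coord_group n). h \<otimes>\<^bsub>coord_group n\<^esub> g = \<one>\<^bsub>coord_group n\<^esub>" by blast
qed

end

theory Submission
  imports Defs "HOL-Library.Function_Algebras"
begin

text \<open>
  The form \<open>ewt mod 2\<close> is a quadratic form of plus type on \<open>L\<^sup>n\<close>, and an even self-dual code is a
  maximal totally singular subspace. Let \<open>e\<close> be the singular vector with the single entry \<open>\<omega>\<close> in
  the last coordinate. Sending \<open>C\<close> to \<open>(C \<inter> e\<^sup>\<bottom> + e) / e\<close> maps the codes of length \<open>n + 1\<close> to those
  of length \<open>n\<close>. In the fibre over \<open>D\<close> exactly one code contains \<open>e\<close>. Every other code of the fibre is
  determined by any one of its vectors that are not orthogonal to \<open>e\<close>, of which it has \<open>|D| = 2\<^sup>n\<close>;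
  as there are \<open>4\<^sup>n\<close> singular vectors not orthogonal to \<open>e\<close>, the fibre has \<open>1 + 2\<^sup>n\<close> elements. The
  class sum is the orbit-stabilizer theorem.
\<close>

text \<open>Keeps addition of bits in additive form, so that the group laws and
  \<open>sum.distrib\<close> apply to sums over coordinates.\<close>

declare add_bit_eq_xor [simp del]

section \<open>The quadratic form on \<open>L\<^sup>n\<close>\<close>

lemma klein_add_self [simp]: "x + x = (0 :: klein)"
  by (cases x) (simp_all add: zero_klein_def)

lemma klein_add_eq_0_iff: "x + y = 0 \<longleftrightarrow> x = (y :: klein)"
  by (cases x; cases y) (simp_all add: zero_klein_def)

lemma sqnorm_zero [simp]: "sqnorm 0 = 0"
  by (simp add: zero_klein_def)

lemma vec_add_self [simp]: "x + x = (0 :: nat \<Rightarrow> klein)"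
  by (simp add: fun_eq_iff)

lemma vec_add_cancel [simp]: "x + (x + y) = (y :: nat \<Rightarrow> klein)"
  by (simp flip: add.assoc)

lemma kdot_zero [simp]: "kdot 0 y = 0" "kdot x 0 = 0"
  using kdot_eq_1_iff by (metis bit_not_one_iff)+

lemma kdot_self [simp]: "kdot x x = 0"
  using kdot_eq_1_iff by (metis bit_not_one_iff)

lemma kdot_commute: "kdot x y = kdot y x"
  by (simp add: kdot_def add.commute)

lemma kdot_add_left: "kdot (x + y) z = kdot x z + kdot y z"
  by (cases x; cases y; cases z) (simp_all add: kdot_def qform_def)

text \<open>The line \<open>{0, Omega}\<close> is its own orthogonal complement in \<open>L\<close>.
  So orthogonality to \<open>last_Omega n\<close> leaves just two values for the last entry, both of
  even norm and orthogonal to each other.\<close>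

lemma kdot_Omega_eq_0_iff: "kdot c Omega = 0 \<longleftrightarrow> c = 0 \<or> c = Omega"
  using kdot_eq_1_iff[of c Omega] by (auto simp: zero_klein_def)

lemma scalar_prod_commute: "scalar_prod n x y = scalar_prod n y x"
  by (simp add: scalar_prod_def kdot_commute)

lemma scalar_prod_zero [simp]: "scalar_prod n 0 y = 0" "scalar_prod n x 0 = 0"
  by (simp_all add: scalar_prod_def)

lemma scalar_prod_self [simp]: "scalar_prod n x x = 0"
  by (simp add: scalar_prod_def)

lemma scalar_prod_add_left: "scalar_prod n (x + y) z = scalar_prod n x z + scalar_prod n y z"
  by (simp add: scalar_prod_def kdot_add_left sum.distrib)

lemma scalar_prod_add_right: "scalar_prod n x (y + z) = scalar_prod n x y + scalar_prod n x z"
  by (metis scalar_prod_add_left scalar_prod_commute)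

lemma scalar_prod_Suc: "scalar_prod (Suc n) x y = scalar_prod n x y + kdot (x n) (y n)"
  by (simp add: scalar_prod_def)

lemma scalar_prod_upd [simp]:
  "scalar_prod n (x(n := c)) y = scalar_prod n x y" "scalar_prod n x (y(n := c)) = scalar_prod n x y"
  by (simp_all add: scalar_prod_def)

lemma ewt_zero [simp]: "ewt n 0 = 0"
  by (simp add: ewt_def)

lemma ewt_Suc: "ewt (Suc n) x = ewt n x + sqnorm (x n)"
  by (simp add: ewt_def)

lemma ewt_upd [simp]: "ewt n (x(n := c)) = ewt n x"
  by (simp add: ewt_def)

lemma even_ewt_iff: "even (ewt n x) \<longleftrightarrow> (\<Sum>i<n. qform (x i)) = 0"
proof -
  have "(\<Sum>i<n. qform (x i)) = of_nat (ewt n x)"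
    by (simp add: ewt_def qform_def)
  moreover have "(of_nat k :: bit) = 0 \<longleftrightarrow> even k" for k
    by (cases "of_nat k :: bit") (metis even_of_nat_iff even_zero, metis even_of_nat_iff odd_one zero_neq_one)
  ultimately show ?thesis by simp
qed

text \<open>\<open>ewt\<close> modulo 2 is a quadratic form with polar form
  \<open>scalar_prod\<close>, hence additive on orthogonal pairs.\<close>

lemma even_ewt_add:
  assumes "scalar_prod n x y = 0"
  shows "even (ewt n (x + y)) \<longleftrightarrow> (even (ewt n x) \<longleftrightarrow> even (ewt n y))"
proof -
  have "qform (a + b) = kdot a b + qform a + qform b" for a b
    by (cases "qform a"; cases "qform b"; cases "qform (a + b)") (simp_all add: kdot_def)
  then have "(\<Sum>i<n. qform ((x + y) i)) = scalar_prod n x y + (\<Sum>i<n. qform (x i)) + (\<Sum>i<n. qform (y i))"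
    by (simp add: scalar_prod_def sum.distrib)
  then show ?thesis
    unfolding even_ewt_iff assms
    by (cases "\<Sum>i<n. qform (x i)"; cases "\<Sum>i<n. qform (y i)") simp_all
qed

section \<open>The space of vectors of length \<open>n\<close> and its size\<close>

lemma carrier_Lpow: "carrier (Lpow n) = {x. \<forall>i\<ge>n. x i = 0}"
  by (simp add: Lpow_def)

lemma zero_in_Lpow [simp]: "0 \<in> carrier (Lpow n)"
  by (simp add: carrier_Lpow)

lemma add_in_Lpow: "x \<in> carrier (Lpow n) \<Longrightarrow> y \<in> carrier (Lpow n) \<Longrightarrow> x + y \<in> carrier (Lpow n)"
  by (simp add: carrier_Lpow)

lemma Lpow_mono: "x \<in> carrier (Lpow n) \<Longrightarrow> x \<in> carrier (Lpow (Suc n))"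
  by (simp add: carrier_Lpow)

lemma upd_in_Lpow_Suc:
  assumes "x \<in> carrier (Lpow n)"
  shows "x(n := c) \<in> carrier (Lpow (Suc n))" "x(n := 0) = x"
  using assms by (auto simp: carrier_Lpow fun_eq_iff)

lemma upd_zero_in_Lpow: "x \<in> carrier (Lpow (Suc n)) \<Longrightarrow> x(n := 0) \<in> carrier (Lpow n)"
  by (auto simp: carrier_Lpow)

text \<open>A vector of length \<open>n + 1\<close> is uniquely a vector of length \<open>n\<close>
  with one of four values put in position \<open>n\<close>.\<close>

lemma finite_card_Lpow: "finite (carrier (Lpow n)) \<and> card (carrier (Lpow n)) = 4 ^ n"
proof (induction n)
  case 0
  have "carrier (Lpow 0) = {0}"
    by (auto simp: carrier_Lpow fun_eq_iff)
  then show ?case by simp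
next
  case (Suc n)
  have UNIV_klein: "(UNIV :: klein set) = {K0, K1, Omega, OmegaBar}"
    using klein.exhaust by blast
  let ?f = "\<lambda>(x, c). x(n := c) :: nat \<Rightarrow> klein"
  have img: "carrier (Lpow (Suc n)) = ?f ` (carrier (Lpow n) \<times> UNIV)"
  proof (intro equalityI subsetI)
    fix x assume "x \<in> carrier (Lpow (Suc n))"
    then have "x = ?f (x(n := 0), x n)" "x(n := 0) \<in> carrier (Lpow n)"
      by (simp_all add: upd_zero_in_Lpow)
    then show "x \<in> ?f ` (carrier (Lpow n) \<times> UNIV)" by blast
  qed (auto intro: upd_in_Lpow_Suc)
  \<comment> \<open>By the zero padding \<open>x n = 0\<close>, so resetting that entry recovers
    \<open>x\<close>, and reading it recovers \<open>c\<close>.\<close>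
  moreover have "inj_on ?f (carrier (Lpow n) \<times> UNIV)"
    by (rule inj_onI, clarsimp) (metis fun_upd_same fun_upd_upd upd_in_Lpow_Suc(2))
  ultimately show ?case
    using Suc by (simp add: card_image card_cartesian_product UNIV_klein)
qed

lemma finite_Lpow: "finite (carrier (Lpow n))"
  and card_Lpow: "card (carrier (Lpow n)) = 4 ^ n"
  using finite_card_Lpow by auto

section \<open>Even self-dual codes\<close>

lemma dual_code_subgroup: "subgroup (dual_code n C) (Lpow n)"
proof
  fix x assume x: "x \<in> dual_code n C"
  then have xV: "x \<in> carrier (Lpow n)" by (simp add: dual_code_def)
  \<comment> \<open>The group has exponent 2, so every element is its own inverse.\<close>
  have "x \<otimes>\<^bsub>Lpow n\<^esub> y = \<one>\<^bsub>Lpow n\<^esub> \<longleftrightarrow> x = y" for y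
    by (simp add: Lpow_def fun_eq_iff klein_add_eq_0_iff)
  with xV have "inv\<^bsub>Lpow n\<^esub> x = x"
    unfolding m_inv_def by (intro the_equality) metis+
  with x show "inv\<^bsub>Lpow n\<^esub> x \<in> dual_code n C" by simp
next
  fix x y assume "x \<in> dual_code n C" "y \<in> dual_code n C"
  then have "x + y \<in> dual_code n C"
    by (simp add: dual_code_def add_in_Lpow scalar_prod_add_left)
  then show "x \<otimes>\<^bsub>Lpow n\<^esub> y \<in> dual_code n C"
    by (simp add: Lpow_def plus_fun_def)
next
  have "0 \<in> dual_code n C" by (simp add: dual_code_def)
  then show "\<one>\<^bsub>Lpow n\<^esub> \<in> dual_code n C" by (simp add: Lpow_def zero_fun_def)
qed (auto simp: dual_code_def)

lemma even_self_dual_codes_eq: "even_self_dual_codes n = {C. C = dual_code n C \<and> even_code n C}"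
  unfolding even_self_dual_codes_def L_code_def self_dual_def
  using dual_code_subgroup by (intro Collect_cong) metis

text \<open>Self-duality is split into its two inclusions, mutual orthogonality and maximality.
  Later proofs use only this form and its converse below.\<close>

lemma even_self_dual_codesI:
  assumes "C \<subseteq> carrier (Lpow n)"
    and "\<And>x y. x \<in> C \<Longrightarrow> y \<in> C \<Longrightarrow> scalar_prod n x y = 0"
    and "\<And>x. x \<in> C \<Longrightarrow> even (ewt n x)"
    and "\<And>x. x \<in> carrier (Lpow n) \<Longrightarrow> (\<And>y. y \<in> C \<Longrightarrow> scalar_prod n x y = 0) \<Longrightarrow> x \<in> C"
  shows "C \<in> even_self_dual_codes n"
proof -
  have "C = dual_code n C"
    using assms(1,2,4) by (intro equalityI subsetI) (auto simp: dual_code_def)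
  then show ?thesis
    using assms(3) unfolding even_self_dual_codes_eq even_code_def by blast
qed

lemma
  assumes C: "C \<in> even_self_dual_codes n"
  shows code_subset: "C \<subseteq> carrier (Lpow n)"
    and code_orth: "\<And>x y. x \<in> C \<Longrightarrow> y \<in> C \<Longrightarrow> scalar_prod n x y = 0"
    and code_even: "\<And>x. x \<in> C \<Longrightarrow> even (ewt n x)"
    and code_maximal: "\<And>x. x \<in> carrier (Lpow n) \<Longrightarrow> (\<And>y. y \<in> C \<Longrightarrow> scalar_prod n x y = 0) \<Longrightarrow> x \<in> C"
proof -
  have C_eq: "C = dual_code n C" and C_even: "even_code n C"
    using C unfolding even_self_dual_codes_eq by blast+
  have mem: "x \<in> C \<longleftrightarrow> x \<in> carrier (Lpow n) \<and> (\<forall>y\<in>C. scalar_prod n x y = 0)" for x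
    by (subst C_eq) (simp add: dual_code_def)
  then show "C \<subseteq> carrier (Lpow n)"
    "\<And>x y. x \<in> C \<Longrightarrow> y \<in> C \<Longrightarrow> scalar_prod n x y = 0"
    "\<And>x. x \<in> carrier (Lpow n) \<Longrightarrow> (\<And>y. y \<in> C \<Longrightarrow> scalar_prod n x y = 0) \<Longrightarrow> x \<in> C"
    by blast+
  show "\<And>x. x \<in> C \<Longrightarrow> even (ewt n x)"
    using C_even by (simp add: even_code_def)
qed

lemma code_zero: "C \<in> even_self_dual_codes n \<Longrightarrow> 0 \<in> C"
  by (rule code_maximal) simp_all

lemma code_add:
  assumes "C \<in> even_self_dual_codes n" "x \<in> C" "y \<in> C"
  shows "x + y \<in> C"
proof (rule code_maximal[OF assms(1)])
  show "x + y \<in> carrier (Lpow n)"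
    using assms code_subset by (blast intro: add_in_Lpow)
  show "scalar_prod n (x + y) z = 0" if "z \<in> C" for z
    using that assms by (simp add: scalar_prod_add_left code_orth)
qed

lemma finite_even_self_dual_codes: "finite (even_self_dual_codes n)"
  by (rule finite_subset[of _ "Pow (carrier (Lpow n))"]) (use code_subset finite_Lpow in auto)

lemma even_self_dual_codes_0: "even_self_dual_codes 0 = {{0}}"
proof -
  have "dual_code 0 C = {0}" for C
    by (auto simp: dual_code_def carrier_Lpow scalar_prod_def fun_eq_iff)
  moreover have "even_code 0 {0}"
    by (simp add: even_code_def)
  ultimately show ?thesis
    unfolding even_self_dual_codes_eq by (simp only:) blast
qed

section \<open>Shortening and extending codes\<close>

definition last_Omega :: "nat \<Rightarrow> nat \<Rightarrow> klein" where
  "last_Omega n = 0(n := Omega)"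

text \<open>The map to the quotient by \<open>e = last_Omega n\<close>. The selected vectors are
  those orthogonal to \<open>e\<close>; their last entry is \<open>0\<close> or
  \<open>Omega\<close>, and zeroing it is reduction modulo \<open>e\<close>.\<close>

definition shorten :: "nat \<Rightarrow> (nat \<Rightarrow> klein) set \<Rightarrow> (nat \<Rightarrow> klein) set" where
  "shorten n C = (\<lambda>x. x(n := 0)) ` {x \<in> C. kdot (x n) Omega = 0}"

text \<open>The preimage of \<open>D\<close> in the complement of \<open>last_Omega n\<close>, cut
  down to the vectors orthogonal to \<open>w\<close>. For an odd pivot the cut keeps one of the two
  lifts of each vector of \<open>D\<close>; for \<open>w = last_Omega n\<close> it keeps
  both.\<close>

definition orth_lift :: "nat \<Rightarrow> (nat \<Rightarrow> klein) set \<Rightarrow> (nat \<Rightarrow> klein) \<Rightarrow> (nat \<Rightarrow> klein) set" where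
  "orth_lift n D w = {y \<in> carrier (Lpow (Suc n)).
     kdot (y n) Omega = 0 \<and> y(n := 0) \<in> D \<and> scalar_prod (Suc n) y w = 0}"

definition extend :: "nat \<Rightarrow> (nat \<Rightarrow> klein) set \<Rightarrow> (nat \<Rightarrow> klein) \<Rightarrow> (nat \<Rightarrow> klein) set" where
  "extend n D w = orth_lift n D w \<union> (+) w ` orth_lift n D w"

text \<open>
  A code containing a pivot \<open>w\<close> is recovered from its shortening as \<open>extend n D w\<close>. The vectors of
  \<open>odd_pivots\<close> are the singular vectors not orthogonal to \<open>last_Omega n\<close>; the remaining pivot,
  \<open>last_Omega n\<close> itself, lies in every code that contains no odd pivot.
\<close>

definition odd_pivots :: "nat \<Rightarrow> (nat \<Rightarrow> klein) set" where
  "odd_pivots n = {w \<in> carrier (Lpow (Suc n)). even (ewt (Suc n) w) \<and> kdot (w n) Omega = 1}"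

definition pivots :: "nat \<Rightarrow> (nat \<Rightarrow> klein) set" where
  "pivots n = insert (last_Omega n) (odd_pivots n)"

section \<open>Pivots and lifts\<close>

lemma scalar_prod_last_Omega: "scalar_prod (Suc n) x (last_Omega n) = kdot (x n) Omega"
  by (simp add: last_Omega_def scalar_prod_Suc)

lemma pivotsD:
  assumes "w \<in> pivots n"
  shows "w \<in> carrier (Lpow (Suc n))" "even (ewt (Suc n) w)" "kdot (w n) Omega = 1 \<or> w = last_Omega n"
  using assms by (auto simp: pivots_def odd_pivots_def last_Omega_def carrier_Lpow ewt_Suc)

lemma shorten_subset: "C \<subseteq> carrier (Lpow (Suc n)) \<Longrightarrow> shorten n C \<subseteq> carrier (Lpow n)"
  by (auto simp: shorten_def upd_zero_in_Lpow)

text \<open>The last entry may be \<open>0\<close> or \<open>Omega\<close>. For an odd pivot,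
  passing from one to the other flips the product with \<open>w\<close>; for
  \<open>w = last_Omega n\<close> the product vanishes for both.\<close>

lemma obtain_orth_lift:
  assumes "w \<in> pivots n" "z \<in> carrier (Lpow n)"
  obtains y where "y \<in> carrier (Lpow (Suc n))" "kdot (y n) Omega = 0" "y(n := 0) = z"
    "scalar_prod (Suc n) y w = 0"
proof -
  have "\<exists>c. kdot c Omega = 0 \<and> scalar_prod (Suc n) (z(n := c)) w = 0"
  proof (cases "scalar_prod n z w = 0")
    case True
    then show ?thesis by (intro exI[of _ 0]) (simp add: scalar_prod_Suc)
  next
    case False
    then have "w \<noteq> last_Omega n"
      by (auto simp: last_Omega_def)
    then have "kdot Omega (w n) = 1"
      using pivotsD(3)[OF assms(1)] by (simp add: kdot_commute)
    with False show ?thesis by (intro exI[of _ Omega]) (simp add: scalar_prod_Suc)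
  qed
  then obtain c where "kdot c Omega = 0" "scalar_prod (Suc n) (z(n := c)) w = 0"
    by blast
  with that[of "z(n := c)"] upd_in_Lpow_Suc[OF assms(2)] show thesis
    by simp
qed

text \<open>Entries from \<open>{0, Omega}\<close> are mutually orthogonal, so the last coordinate
  contributes nothing.\<close>

lemma scalar_prod_Suc_orth:
  assumes "kdot (x n) Omega = 0" "kdot (y n) Omega = 0"
  shows "scalar_prod (Suc n) x y = scalar_prod n (x(n := 0)) (y(n := 0))"
  using assms by (auto simp: kdot_Omega_eq_0_iff scalar_prod_Suc)

text \<open>The lift inherits total singularity from \<open>D\<close>, since last entries in
  \<open>{0, Omega}\<close> affect neither the parity of the weight nor the products.\<close>

lemma orth_liftD:
  assumes "D \<in> even_self_dual_codes n" "x \<in> orth_lift n D w"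
  shows "x \<in> carrier (Lpow (Suc n))" "kdot (x n) Omega = 0" "scalar_prod (Suc n) x w = 0"
    "even (ewt (Suc n) x)"
    "y \<in> orth_lift n D w \<Longrightarrow> scalar_prod (Suc n) x y = 0"
proof -
  show x: "x \<in> carrier (Lpow (Suc n))" "kdot (x n) Omega = 0" "scalar_prod (Suc n) x w = 0"
    using assms by (auto simp: orth_lift_def)
  have "even (ewt n x)"
    using code_even[OF assms(1), of "x(n := 0)"] assms(2) by (simp add: orth_lift_def)
  then show "even (ewt (Suc n) x)"
    using x(2) by (auto simp: ewt_Suc kdot_Omega_eq_0_iff zero_klein_def)
  show "scalar_prod (Suc n) x y = 0" if "y \<in> orth_lift n D w"
    using that assms(2) scalar_prod_Suc_orth[of x n y] code_orth[OF assms(1), of "x(n := 0)" "y(n := 0)"]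
    by (auto simp: orth_lift_def)
qed

section \<open>Extension and shortening as inverse constructions\<close>

lemma zero_in_orth_lift: "D \<in> even_self_dual_codes n \<Longrightarrow> 0 \<in> orth_lift n D w"
proof -
  assume "D \<in> even_self_dual_codes n"
  moreover have "(0 :: nat \<Rightarrow> klein)(n := 0) = 0" by (simp add: fun_eq_iff)
  ultimately show ?thesis by (simp add: orth_lift_def code_zero)
qed

lemma pivot_in_extend: "D \<in> even_self_dual_codes n \<Longrightarrow> w \<in> extend n D w"
  unfolding extend_def using zero_in_orth_lift[of D n w] by force

text \<open>Adding the singular vector \<open>w\<close>, orthogonal to the lift, keeps total
  singularity. For maximality, a vector orthogonal to the extension is first moved into the
  complement of \<open>last_Omega n\<close>, by adding \<open>w\<close> if necessary. There its
  shortening is orthogonal to \<open>D\<close>, hence lies in \<open>D\<close>.\<close>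

lemma extend_in_codes:
  assumes D: "D \<in> even_self_dual_codes n" and w: "w \<in> pivots n"
  shows "extend n D w \<in> even_self_dual_codes (Suc n)"
proof (rule even_self_dual_codesI)
  note H = orth_liftD[OF D]
  note wV = pivotsD(1)[OF w] and we = pivotsD(2)[OF w] and wcases = pivotsD(3)[OF w]
  have wH: "scalar_prod (Suc n) w h = 0" if "h \<in> orth_lift n D w" for h
    using H(3)[OF that] by (simp add: scalar_prod_commute)
  show "extend n D w \<subseteq> carrier (Lpow (Suc n))"
    using H(1) wV by (auto simp: extend_def intro: add_in_Lpow)
  show orth: "scalar_prod (Suc n) x y = 0" if "x \<in> extend n D w" "y \<in> extend n D w" for x y
    using that H(3,5) wH
    by (auto simp: extend_def scalar_prod_add_left scalar_prod_add_right)
  show "even (ewt (Suc n) x)" if "x \<in> extend n D w" for x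
    using that H(4) we even_ewt_add[OF wH] by (auto simp: extend_def)
  fix x assume xV: "x \<in> carrier (Lpow (Suc n))"
    and x: "\<And>y. y \<in> extend n D w \<Longrightarrow> scalar_prod (Suc n) x y = 0"
  have in_lift: "z \<in> orth_lift n D w"
    if zV: "z \<in> carrier (Lpow (Suc n))" and zk: "kdot (z n) Omega = 0"
      and z: "\<And>y. y \<in> extend n D w \<Longrightarrow> scalar_prod (Suc n) z y = 0" for z
  proof -
    have "z(n := 0) \<in> D"
    proof (rule code_maximal[OF D])
      show "z(n := 0) \<in> carrier (Lpow n)" using zV by (rule upd_zero_in_Lpow)
      fix d assume d: "d \<in> D"
      then obtain y where y: "y \<in> carrier (Lpow (Suc n))" "kdot (y n) Omega = 0" "y(n := 0) = d"
        "scalar_prod (Suc n) y w = 0"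
        using obtain_orth_lift[OF w] code_subset[OF D] by blast
      then have "y \<in> extend n D w" using d by (simp add: extend_def orth_lift_def)
      from z[OF this] show "scalar_prod n (z(n := 0)) d = 0"
        using scalar_prod_Suc_orth[of z n y] zk y(2,3) by simp
    qed
    then show ?thesis
      using zV zk z[OF pivot_in_extend[OF D]] by (simp add: orth_lift_def)
  qed
  show "x \<in> extend n D w"
  proof (cases "kdot (x n) Omega = 0")
    case True
    with in_lift[OF xV _ x] show ?thesis by (simp add: extend_def)
  next
    case False
    \<comment> \<open>\<open>w\<close> lies in the extension, so \<open>x\<close> is orthogonal to
      \<open>w\<close> but not to \<open>last_Omega n\<close>.\<close>
    then have "w \<noteq> last_Omega n"
      using x[OF pivot_in_extend[OF D]] by (auto simp: scalar_prod_last_Omega)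
    then have "kdot (w n) Omega = 1" using wcases by simp
    with False have "w + x \<in> orth_lift n D w"
      using x orth pivot_in_extend[OF D] xV wV
      by (intro in_lift) (auto simp: kdot_add_left scalar_prod_add_left intro: add_in_Lpow)
    then have "w + (w + x) \<in> extend n D w" unfolding extend_def by blast
    then show ?thesis by simp
  qed
qed

text \<open>For an odd pivot the coset of \<open>w\<close> is not orthogonal to
  \<open>last_Omega n\<close> and disappears on shortening; for \<open>w = last_Omega n\<close>,
  adding \<open>w\<close> changes only the entry that is zeroed.\<close>

lemma shorten_extend:
  assumes D: "D \<in> even_self_dual_codes n" and w: "w \<in> pivots n"
  shows "shorten n (extend n D w) = D"
proof (intro equalityI subsetI)
  fix x assume "x \<in> shorten n (extend n D w)"
  then obtain y where y: "y \<in> extend n D w" "kdot (y n) Omega = 0" "x = y(n := 0)"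
    by (auto simp: shorten_def)
  from y(1) show "x \<in> D"
    unfolding extend_def
  proof
    assume "y \<in> (+) w ` orth_lift n D w"
    then obtain h where h: "h \<in> orth_lift n D w" "y = w + h" by blast
    then have "w = last_Omega n"
      using y(2) pivotsD(3)[OF w] orth_liftD(2)[OF D h(1)] by (auto simp: kdot_add_left)
    then have "x = h(n := 0)"
      using h(2) y(3) by (auto simp: last_Omega_def fun_eq_iff)
    then show ?thesis using h(1) by (simp add: orth_lift_def)
  qed (use y in \<open>simp add: orth_lift_def\<close>)
next
  fix d assume d: "d \<in> D"
  then obtain y where y: "y \<in> carrier (Lpow (Suc n))" "kdot (y n) Omega = 0" "y(n := 0) = d"
    "scalar_prod (Suc n) y w = 0"
    using obtain_orth_lift[OF w] code_subset[OF D] by blast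
  then have "y \<in> extend n D w" using d by (simp add: extend_def orth_lift_def)
  with y show "d \<in> shorten n (extend n D w)" by (auto simp: shorten_def)
qed

text \<open>A vector of the lift agrees with some codeword up to the last entry. If they differ
  there, they differ by \<open>last_Omega n\<close>; as both are orthogonal to \<open>w\<close>, the
  pivot is not odd, so the difference is \<open>w\<close> itself. Conversely, a codeword, or its sum
  with \<open>w\<close>, is orthogonal to \<open>last_Omega n\<close> and so lies in the
  lift.\<close>

lemma extend_shorten:
  assumes C: "C \<in> even_self_dual_codes (Suc n)" and w: "w \<in> pivots n" "w \<in> C"
  shows "extend n (shorten n C) w = C"
proof (intro equalityI subsetI)
  have "orth_lift n (shorten n C) w \<subseteq> C"
  proof
    fix y assume y: "y \<in> orth_lift n (shorten n C) w"
    then obtain x where x: "x \<in> C" "kdot (x n) Omega = 0" "y(n := 0) = x(n := 0)"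
      by (auto simp: orth_lift_def shorten_def)
    have yk: "kdot (y n) Omega = 0" and yw: "scalar_prod (Suc n) y w = 0"
      using y by (auto simp: orth_lift_def)
    have yx: "y i = x i" if "i \<noteq> n" for i
      using fun_cong[OF x(3), of i] that by simp
    show "y \<in> C"
    proof (cases "y n = x n")
      case True
      then have "y = x" using yx by (metis ext)
      with x show ?thesis by simp
    next
      case False
      have "scalar_prod n y w = scalar_prod n x w"
        using x(3) by (metis scalar_prod_upd(1))
      then have "kdot (y n) (w n) = kdot (x n) (w n)"
        using yw code_orth[OF C x(1) w(2)] unfolding scalar_prod_Suc by (metis add_left_cancel)
      then have "kdot (w n) Omega = 0"
        using False x(2) yk by (auto simp: kdot_Omega_eq_0_iff[of "x n"] kdot_Omega_eq_0_iff[of "y n"]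
            kdot_commute[of "w n"])
      then have "w = last_Omega n"
        using pivotsD(3)[OF w(1)] by simp
      then have "y = x + w"
        using False x(2) yk yx by (auto simp: kdot_Omega_eq_0_iff fun_eq_iff last_Omega_def)
      then show ?thesis using code_add[OF C x(1) w(2)] by simp
    qed
  qed
  then show "x \<in> C" if "x \<in> extend n (shorten n C) w" for x
    using that code_add[OF C w(2)] by (auto simp: extend_def)
  have in_lift: "x \<in> orth_lift n (shorten n C) w" if "x \<in> C" "kdot (x n) Omega = 0" for x
    using that code_orth[OF C that(1) w(2)] code_subset[OF C] by (auto simp: orth_lift_def shorten_def)
  fix x assume x: "x \<in> C"
  show "x \<in> extend n (shorten n C) w"
  proof (cases "kdot (x n) Omega = 0")
    case True
    with in_lift[OF x] show ?thesis by (simp add: extend_def)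
  next
    case False
    then have "w \<noteq> last_Omega n"
      using code_orth[OF C x w(2)] by (auto simp: scalar_prod_last_Omega)
    then have "kdot (w n) Omega = 1"
      using pivotsD(3)[OF w(1)] by simp
    with False have "w + x \<in> orth_lift n (shorten n C) w"
      by (intro in_lift code_add[OF C] x w) (simp add: kdot_add_left)
    then have "w + (w + x) \<in> extend n (shorten n C) w" unfolding extend_def by blast
    then show ?thesis by simp
  qed
qed

text \<open>By maximality, \<open>last_Omega n\<close> can be missing from \<open>C\<close> only if
  some codeword is not orthogonal to it, and that codeword is an odd pivot.\<close>

lemma obtain_pivot:
  assumes C: "C \<in> even_self_dual_codes (Suc n)"
  obtains w where "w \<in> pivots n" "w \<in> C"
proof (cases "last_Omega n \<in> C")
  case True
  then show thesis by (intro that[of "last_Omega n"]) (simp_all add: pivots_def)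
next
  case False
  moreover have "last_Omega n \<in> carrier (Lpow (Suc n))"
    by (simp add: last_Omega_def carrier_Lpow)
  ultimately obtain w where w: "w \<in> C" "scalar_prod (Suc n) (last_Omega n) w \<noteq> 0"
    using code_maximal[OF C] by blast
  then have "kdot (w n) Omega = 1"
    by (simp add: scalar_prod_commute[of _ "last_Omega n"] scalar_prod_last_Omega)
  then have "w \<in> odd_pivots n"
    using w(1) code_subset[OF C] code_even[OF C] by (auto simp: odd_pivots_def)
  with w(1) show thesis by (intro that[of w]) (simp_all add: pivots_def)
qed

lemma shorten_in_codes:
  assumes C: "C \<in> even_self_dual_codes (Suc n)"
  shows "shorten n C \<in> even_self_dual_codes n"
proof -
  obtain w where w: "w \<in> pivots n" "w \<in> C" using obtain_pivot[OF C] .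
  show ?thesis
  proof (rule even_self_dual_codesI)
    show "shorten n C \<subseteq> carrier (Lpow n)"
      using code_subset[OF C] by (rule shorten_subset)
    show "scalar_prod n x y = 0" if "x \<in> shorten n C" "y \<in> shorten n C" for x y
    proof -
      obtain x' where "x' \<in> C" "kdot (x' n) Omega = 0" "x = x'(n := 0)"
        using \<open>x \<in> shorten n C\<close> by (auto simp: shorten_def)
      moreover obtain y' where "y' \<in> C" "kdot (y' n) Omega = 0" "y = y'(n := 0)"
        using \<open>y \<in> shorten n C\<close> by (auto simp: shorten_def)
      ultimately show ?thesis
        using scalar_prod_Suc_orth[of x' n y'] code_orth[OF C] by simp
    qed
    show "even (ewt n x)" if "x \<in> shorten n C" for x
    proof -
      obtain y where "y \<in> C" "kdot (y n) Omega = 0" "x = y(n := 0)"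
        using \<open>x \<in> shorten n C\<close> by (auto simp: shorten_def)
      then show ?thesis
        using code_even[OF C, of y] by (auto simp: ewt_Suc kdot_Omega_eq_0_iff zero_klein_def)
    qed
    fix z assume zV: "z \<in> carrier (Lpow n)"
      and z: "\<And>y. y \<in> shorten n C \<Longrightarrow> scalar_prod n z y = 0"
    obtain y where y: "y \<in> carrier (Lpow (Suc n))" "kdot (y n) Omega = 0" "y(n := 0) = z"
      "scalar_prod (Suc n) y w = 0"
      using obtain_orth_lift[OF w(1) zV] .
    have yH: "scalar_prod (Suc n) y h = 0" if "h \<in> orth_lift n (shorten n C) w" for h
      using that scalar_prod_Suc_orth[of y n h] y(2,3) z[of "h(n := 0)"] by (simp add: orth_lift_def)
    \<comment> \<open>By \<open>extend_shorten\<close>, \<open>C\<close> consists of the lift and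
      its translate by \<open>w\<close>, so orthogonality to the lift and to \<open>w\<close>
      suffices.\<close>
    have "y \<in> C"
    proof (rule code_maximal[OF C y(1)])
      fix x assume "x \<in> C"
      then have "x \<in> extend n (shorten n C) w" using extend_shorten[OF C w] by simp
      then show "scalar_prod (Suc n) y x = 0"
        using yH y(4) by (auto simp: extend_def scalar_prod_add_right)
    qed
    with y(2,3) show "z \<in> shorten n C" by (auto simp: shorten_def)
  qed
qed

section \<open>Counting\<close>

text \<open>Zeroing the last entry is a bijection onto \<open>D\<close>: exactly one of the two
  lifts of a vector is orthogonal to an odd pivot.\<close>

lemma card_orth_lift:
  assumes D: "D \<in> even_self_dual_codes n" and w: "w \<in> odd_pivots n"
  shows "card (orth_lift n D w) = card D"
proof (rule bij_betw_same_card, unfold bij_betw_def, intro conjI)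
  let ?f = "\<lambda>x. x(n := 0)"
  have wp: "w \<in> pivots n" and wk: "kdot Omega (w n) = 1"
    using w by (auto simp: pivots_def odd_pivots_def kdot_commute)
  show "inj_on ?f (orth_lift n D w)"
  proof (rule inj_onI)
    fix x y assume x: "x \<in> orth_lift n D w" and y: "y \<in> orth_lift n D w" and eq: "?f x = ?f y"
    have "scalar_prod n x w = scalar_prod n y w"
      using eq by (metis scalar_prod_upd(1))
    then have "kdot (x n) (w n) = kdot (y n) (w n)"
      using x y unfolding orth_lift_def scalar_prod_Suc mem_Collect_eq by (metis add_left_cancel)
    then have "x n = y n"
      using x y wk by (auto simp: orth_lift_def kdot_Omega_eq_0_iff)
    then show "x = y" using eq by (metis fun_upd_triv fun_upd_upd)
  qed
  show "?f ` orth_lift n D w = D"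
  proof (intro equalityI subsetI)
    fix d assume d: "d \<in> D"
    then obtain y where "y \<in> carrier (Lpow (Suc n))" "kdot (y n) Omega = 0" "?f y = d"
      "scalar_prod (Suc n) y w = 0"
      using obtain_orth_lift[OF wp] code_subset[OF D] by blast
    with d show "d \<in> ?f ` orth_lift n D w"
      by (intro image_eqI[of _ _ y]) (simp_all add: orth_lift_def)
  qed (auto simp: orth_lift_def)
qed

lemma inj_vec_add: "inj_on ((+) w) (A :: (nat \<Rightarrow> klein) set)"
  by (auto simp: inj_on_def)

text \<open>The product with \<open>last_Omega n\<close> separates the two cosets making up the
  extension: it is 0 on the lift and 1 on its translate by \<open>w\<close>.\<close>

lemma extend_Int_odd_pivots:
  assumes D: "D \<in> even_self_dual_codes n" and w: "w \<in> odd_pivots n"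
  shows "extend n D w \<inter> odd_pivots n = (+) w ` orth_lift n D w"
proof -
  have wk: "kdot (w n) Omega = 1" and "w \<in> pivots n"
    using w by (auto simp: odd_pivots_def pivots_def)
  note E = extend_in_codes[OF D this(2)]
  have "w + h \<in> odd_pivots n" if "h \<in> orth_lift n D w" for h
  proof -
    have "w + h \<in> extend n D w" using that by (simp add: extend_def)
    then show ?thesis
      using code_subset[OF E] code_even[OF E] wk orth_liftD(2)[OF D that]
      by (auto simp: odd_pivots_def kdot_add_left)
  qed
  moreover have "orth_lift n D w \<inter> odd_pivots n = {}"
    by (auto simp: orth_lift_def odd_pivots_def)
  ultimately show ?thesis by (auto simp: extend_def)
qed

text \<open>For an odd pivot the extension consists of two disjoint cosets of size
  \<open>card D\<close>. For \<open>w = last_Omega n\<close> the lift already contains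
  \<open>w\<close>, and the extension is the union of \<open>D\<close> and its translate by
  \<open>w\<close>.\<close>

lemma card_extend:
  assumes D: "D \<in> even_self_dual_codes n" and w: "w \<in> pivots n"
  shows "card (extend n D w) = 2 * card D"
proof (cases "w \<in> odd_pivots n")
  case True
  have fin: "finite (orth_lift n D w)"
    by (rule finite_subset[OF _ finite_Lpow[of "Suc n"]]) (auto simp: orth_lift_def)
  have "orth_lift n D w \<inter> (+) w ` orth_lift n D w = {}"
    unfolding extend_Int_odd_pivots[OF D True, symmetric] by (auto simp: orth_lift_def odd_pivots_def)
  then have "card (extend n D w) = card (orth_lift n D w) + card ((+) w ` orth_lift n D w)"
    unfolding extend_def using fin by (intro card_Un_disjoint) auto
  then show ?thesis
    using card_orth_lift[OF D True] by (simp add: card_image inj_vec_add)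
next
  case False
  then have we: "w = last_Omega n" using w by (simp add: pivots_def)
  have fin: "finite D"
    using code_subset[OF D] finite_Lpow finite_subset by blast
  \<comment> \<open>Zero padding lets the vectors of \<open>D\<close> count as vectors of length
    \<open>n + 1\<close> with last entry \<open>0\<close>.\<close>
  have Dn: "d n = 0" if "d \<in> D" for d
    using that code_subset[OF D] by (auto simp: carrier_Lpow)
  have D_lift: "d \<in> orth_lift n D w" if "d \<in> D" for d
    using that code_subset[OF D] upd_in_Lpow_Suc(2)[of d n] Dn[OF that]
    by (auto simp: orth_lift_def we scalar_prod_last_Omega intro: Lpow_mono)
  have lift_D: "x \<in> D \<union> (+) w ` D" if x: "x \<in> orth_lift n D w" for x
  proof (cases "x n = 0")
    case True
    then show ?thesis using x fun_upd_triv[of x n] by (simp add: orth_lift_def)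
  next
    case False
    then have "x n = Omega" using x by (auto simp: orth_lift_def kdot_Omega_eq_0_iff)
    then have "x = w + x(n := 0)" by (auto simp: we last_Omega_def fun_eq_iff)
    then show ?thesis using x by (auto simp: orth_lift_def)
  qed
  have "extend n D w = D \<union> (+) w ` D"
    using D_lift lift_D by (fastforce simp: extend_def)
  moreover have "D \<inter> (+) w ` D = {}"
  proof -
    have "(w + d) n \<noteq> 0" if "d \<in> D" for d
      using Dn[OF that] by (simp add: we last_Omega_def) (simp add: zero_klein_def)
    then show ?thesis using Dn by blast
  qed
  ultimately show ?thesis
    using fin by (simp add: card_Un_disjoint card_image inj_vec_add)
qed

text \<open>Every code contains a pivot and is thus an extension of its shortening, which doubles
  the size.\<close>

lemma card_code: "C \<in> even_self_dual_codes n \<Longrightarrow> card C = 2 ^ n"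
proof (induction n arbitrary: C)
  case 0
  then show ?case by (simp add: even_self_dual_codes_0)
next
  case (Suc n)
  obtain w where w: "w \<in> pivots n" "w \<in> C" using obtain_pivot[OF Suc.prems] .
  then show ?case
    using card_extend[OF shorten_in_codes[OF Suc.prems] w(1)] extend_shorten[OF Suc.prems w]
      Suc.IH[OF shorten_in_codes[OF Suc.prems]] by simp
qed

text \<open>The first \<open>n\<close> entries are free. Non-orthogonality to \<open>Omega\<close>
  leaves \<open>K1\<close> and \<open>OmegaBar\<close> for the last one, and their norms have
  opposite parity, so evenness selects exactly one.\<close>

lemma card_odd_pivots: "card (odd_pivots n) = 4 ^ n"
proof -
  let ?f = "\<lambda>x. x(n := 0)"
  have "bij_betw ?f (odd_pivots n) (carrier (Lpow n))"
    unfolding bij_betw_def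
  proof
    show "inj_on ?f (odd_pivots n)"
    proof (rule inj_onI)
      fix x y assume x: "x \<in> odd_pivots n" and y: "y \<in> odd_pivots n" and eq: "?f x = ?f y"
      have "ewt n x = ewt n y" using eq by (metis ewt_upd)
      then have "even (sqnorm (x n)) \<longleftrightarrow> even (sqnorm (y n))"
        using x y by (auto simp: odd_pivots_def ewt_Suc)
      then have "x n = y n"
        using x y by (cases "x n"; cases "y n") (auto simp: odd_pivots_def kdot_eq_1_iff zero_klein_def)
      then show "x = y" using eq by (metis fun_upd_triv fun_upd_upd)
    qed
    show "?f ` odd_pivots n = carrier (Lpow n)"
    proof (intro equalityI subsetI)
      fix x assume x: "x \<in> carrier (Lpow n)"
      let ?y = "x(n := if even (ewt n x) then OmegaBar else K1)"
      have "?y \<in> odd_pivots n"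
        using upd_in_Lpow_Suc(1)[OF x]
        by (auto simp: odd_pivots_def ewt_Suc kdot_eq_1_iff zero_klein_def)
      moreover have "?f ?y = x" using upd_in_Lpow_Suc(2)[OF x] by simp
      ultimately show "x \<in> ?f ` odd_pivots n" by (metis image_eqI)
    qed (auto simp: odd_pivots_def upd_zero_in_Lpow)
  qed
  then show ?thesis by (simp add: bij_betw_same_card card_Lpow)
qed

text \<open>Double counting: the sets \<open>C \<inter> odd_pivots n\<close>, for the fibre codes
  \<open>C\<close> without \<open>last_Omega n\<close>, partition the odd pivots into blocks of
  equal size.\<close>

lemma card_shorten_fibre:
  assumes D: "D \<in> even_self_dual_codes n"
  shows "card {C \<in> even_self_dual_codes (Suc n). shorten n C = D} = 2 ^ n + 1"
proof -
  let ?e = "last_Omega n"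
  define F where "F = {C \<in> even_self_dual_codes (Suc n). shorten n C = D \<and> ?e \<notin> C}"
  have fin: "finite F" unfolding F_def using finite_even_self_dual_codes by simp
  have e: "?e \<in> pivots n" by (simp add: pivots_def)
  have ext: "C = extend n D w"
    if "C \<in> even_self_dual_codes (Suc n)" "shorten n C = D" "w \<in> C" "w \<in> pivots n" for C w
    using extend_shorten[OF that(1,4,3)] that(2) by simp
  have "{C \<in> even_self_dual_codes (Suc n). shorten n C = D} = insert (extend n D ?e) F"
  proof (intro equalityI subsetI)
    fix C assume C: "C \<in> {C \<in> even_self_dual_codes (Suc n). shorten n C = D}"
    show "C \<in> insert (extend n D ?e) F"
    proof (cases "?e \<in> C")
      case True
      with C ext[of C ?e] e show ?thesis by simp
    next
      case False
      with C show ?thesis by (simp add: F_def)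
    qed
  next
    fix C assume "C \<in> insert (extend n D ?e) F"
    then show "C \<in> {C \<in> even_self_dual_codes (Suc n). shorten n C = D}"
      using extend_in_codes[OF D e] shorten_extend[OF D e] by (auto simp: F_def)
  qed
  moreover have "extend n D ?e \<notin> F"
    using pivot_in_extend[OF D] by (auto simp: F_def)
  ultimately have 1: "card {C \<in> even_self_dual_codes (Suc n). shorten n C = D} = card F + 1"
    using fin by simp
  \<comment> \<open>Each odd pivot \<open>w\<close> lies in the fibre code
    \<open>extend n D w\<close>, which omits \<open>last_Omega n\<close> because \<open>w\<close> is
    not orthogonal to it.\<close>
  have U: "odd_pivots n = (\<Union>C\<in>F. C \<inter> odd_pivots n)"
  proof (intro equalityI subsetI)
    fix w assume w: "w \<in> odd_pivots n"
    then have wp: "w \<in> pivots n" and wk: "kdot (w n) Omega = 1"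
      by (auto simp: pivots_def odd_pivots_def)
    note E = extend_in_codes[OF D wp]
    have "?e \<notin> extend n D w"
    proof
      assume "?e \<in> extend n D w"
      from code_orth[OF E pivot_in_extend[OF D] this] show False
        using wk by (simp add: scalar_prod_last_Omega)
    qed
    then have "extend n D w \<in> F"
      using E shorten_extend[OF D wp] by (simp add: F_def)
    with w pivot_in_extend[OF D] show "w \<in> (\<Union>C\<in>F. C \<inter> odd_pivots n)" by blast
  qed auto
  have cardC: "card (C \<inter> odd_pivots n) = 2 ^ n" if C: "C \<in> F" for C
  proof -
    have C': "C \<in> even_self_dual_codes (Suc n)" "shorten n C = D" "?e \<notin> C"
      using C by (auto simp: F_def)
    obtain w where w: "w \<in> pivots n" "w \<in> C" using obtain_pivot[OF C'(1)] .
    then have wo: "w \<in> odd_pivots n" using C'(3) by (auto simp: pivots_def)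
    have "C \<inter> odd_pivots n = (+) w ` orth_lift n D w"
      using extend_Int_odd_pivots[OF D wo] ext[OF C'(1,2) w(2,1)] by simp
    then show ?thesis
      by (simp add: card_image inj_vec_add card_orth_lift[OF D wo] card_code[OF D])
  qed
  have "4 ^ n = (\<Sum>C\<in>F. card (C \<inter> odd_pivots n))"
    unfolding card_odd_pivots[symmetric]
  proof (subst U, rule card_UN_disjoint[OF fin])
    have "finite (odd_pivots n)"
      by (rule finite_subset[OF _ finite_Lpow[of "Suc n"]]) (auto simp: odd_pivots_def)
    then show "\<forall>C\<in>F. finite (C \<inter> odd_pivots n)" by simp
    show "\<forall>C\<in>F. \<forall>C'\<in>F. C \<noteq> C' \<longrightarrow> C \<inter> odd_pivots n \<inter> (C' \<inter> odd_pivots n) = {}"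
    proof (intro ballI impI)
      fix C C' assume C: "C \<in> F" "C' \<in> F" "C \<noteq> C'"
      \<comment> \<open>A common odd pivot determines both codes.\<close>
      have "C = extend n D w" "C' = extend n D w" if "w \<in> C" "w \<in> C'" "w \<in> odd_pivots n" for w
        using that C ext[of C w] ext[of C' w] by (simp_all add: F_def pivots_def)
      with C(3) show "C \<inter> odd_pivots n \<inter> (C' \<inter> odd_pivots n) = {}" by blast
    qed
  qed
  also have "\<dots> = card F * 2 ^ n" by (simp add: cardC)
  \<comment> \<open>Writing 4 as \<open>2 * 2\<close> exposes a factor \<open>2 ^ n\<close> to
    cancel.\<close>
  finally have "(2 * 2) ^ n = card F * 2 ^ n" by simp
  then have "card F = 2 ^ n" by (simp only: power_mult_distrib) simp
  with 1 show ?thesis by simp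
qed

text \<open>Shortening maps codes of length \<open>n + 1\<close> to codes of length \<open>n\<close>
  with fibres of constant size, so each induction step contributes one factor.\<close>

theorem card_even_self_dual_codes: "card (even_self_dual_codes n) = (\<Prod>i<n. 2 ^ i + 1)"
proof (induction n)
  case 0
  then show ?case by (simp add: even_self_dual_codes_0)
next
  case (Suc n)
  let ?F = "\<lambda>D. {C \<in> even_self_dual_codes (Suc n). shorten n C = D}"
  have "even_self_dual_codes (Suc n) = (\<Union>D\<in>even_self_dual_codes n. ?F D)"
    using shorten_in_codes by auto
  then have "card (even_self_dual_codes (Suc n)) = card (\<Union>D\<in>even_self_dual_codes n. ?F D)"
    by (rule arg_cong)
  also have "\<dots> = (\<Sum>D\<in>even_self_dual_codes n. card (?F D))"
    by (rule card_UN_disjoint) (auto simp: finite_even_self_dual_codes)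
  also have "\<dots> = card (even_self_dual_codes n) * (2 ^ n + 1)"
    by (simp add: card_shorten_fibre)
  finally show ?case using Suc by simp
qed

section \<open>The mass formula\<close>

text \<open>The orbit-stabilizer theorem summed over the orbit partition of \<open>E\<close>, for an
  arbitrary choice \<open>rep\<close> of representatives.\<close>

lemma card_eq_sum_orbits:
  fixes G (structure)
  assumes G: "group G" "finite (carrier G)" and E: "finite E"
    and closed: "\<And>g x. g \<in> carrier G \<Longrightarrow> x \<in> E \<Longrightarrow> \<psi> g x \<in> E"
    and mult: "\<And>g h x. g \<in> carrier G \<Longrightarrow> h \<in> carrier G \<Longrightarrow> x \<in> E \<Longrightarrow> \<psi> (g \<otimes> h) x = \<psi> g (\<psi> h x)"
    and one: "\<And>x. x \<in> E \<Longrightarrow> \<psi> \<one> x = x"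
    and rep: "\<And>K. K \<in> orbits G E \<psi> \<Longrightarrow> rep K \<in> K"
  shows "real (card E) = (\<Sum>K\<in>orbits G E \<psi>. real (order G) / real (card (stabilizer G \<psi> (rep K))))"
proof -
  interpret group G by fact
  \<comment> \<open>Members of \<open>Bij E\<close> are extensional, so the action is restricted to
    \<open>E\<close>; orbits and stabilizers of points of \<open>E\<close> stay the same.\<close>
  define \<phi> where "\<phi> = (\<lambda>g. restrict (\<psi> g) E)"
  have bij: "bij_betw (\<psi> g) E E" if g: "g \<in> carrier G" for g
  proof (rule bij_betw_byWitness[where f' = "\<psi> (inv g)"])
    show "\<forall>x\<in>E. \<psi> (inv g) (\<psi> g x) = x" "\<forall>x\<in>E. \<psi> g (\<psi> (inv g) x) = x"
      using g one mult[of "inv g" g] mult[of g "inv g"] by simp_all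
    show "\<psi> g ` E \<subseteq> E" "\<psi> (inv g) ` E \<subseteq> E"
      using g closed by auto
  qed
  have Bij: "\<phi> g \<in> Bij E" if "g \<in> carrier G" for g
    using bij[OF that] bij_betw_cong[of E "\<phi> g" "\<psi> g" E] by (simp add: \<phi>_def Bij_def)
  have "group_action G E \<phi>"
    unfolding group_action_def group_hom_def group_hom_axioms_def
  proof (intro conjI homI)
    show "group (BijGroup E)" by (rule group_BijGroup)
    show "\<phi> g \<in> carrier (BijGroup E)" if "g \<in> carrier G" for g
      using Bij[OF that] by (simp add: BijGroup_def)
    show "\<phi> (g \<otimes> h) = \<phi> g \<otimes>\<^bsub>BijGroup E\<^esub> \<phi> h" if "g \<in> carrier G" "h \<in> carrier G" for g h
      using Bij[OF that(1)] Bij[OF that(2)] that closed mult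
      by (auto simp: BijGroup_def compose_def \<phi>_def fun_eq_iff)
  qed (rule G)
  then interpret A: group_action G E \<phi> .
  have orbit_eq: "orbit G \<psi> x = orbit G \<phi> x" and stab_eq: "stabilizer G \<psi> x = stabilizer G \<phi> x"
    if "x \<in> E" for x
    using that by (auto simp: orbit_def stabilizer_def \<phi>_def)
  then have orbits_eq: "orbits G E \<psi> = orbits G E \<phi>"
    by (auto simp: orbits_def)
  note part = A.orbit_partition
  have KE: "K \<subseteq> E" if "K \<in> orbits G E \<phi>" for K
    using part that by (rule partition.incl)
  have "card (\<Union>(orbits G E \<phi>)) = (\<Sum>K\<in>orbits G E \<phi>. card K)"
  proof (rule card_Union_disjoint)
    show "pairwise disjnt (orbits G E \<phi>)"
      unfolding pairwise_def disjnt_def using partition.disjoint_union[OF part] by blast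
  qed (use KE E finite_subset in blast)
  also have "\<Union>(orbits G E \<phi>) = E"
    using KE A.orbit_refl by (fastforce simp: orbits_def)
  finally have "real (card E) = (\<Sum>K\<in>orbits G E \<phi>. real (card K))" by simp
  also have "\<dots> = (\<Sum>K\<in>orbits G E \<phi>. real (order G) / real (card (stabilizer G \<psi> (rep K))))"
  proof (rule sum.cong[OF refl])
    fix K assume K: "K \<in> orbits G E \<phi>"
    let ?x = "rep K"
    have xK: "?x \<in> K" using rep K orbits_eq by simp
    then have xE: "?x \<in> E" using KE[OF K] by blast
    \<comment> \<open>Orbits are disjoint, so \<open>K\<close> is the orbit of each of its
      points.\<close>
    have "K = orbit G \<phi> ?x"
      using partition.disjoint_union[OF part K, of "orbit G \<phi> ?x"] xK xE A.orbit_refl[OF xE]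
      by (auto simp: orbits_def)
    then have "card K * card (stabilizer G \<phi> ?x) = order G"
      using A.orbit_stabilizer_theorem[OF xE] by simp
    \<comment> \<open>Positivity makes the stabilizer size nonzero, which the division below
      requires.\<close>
    moreover have "order G > 0"
      using G by (simp add: order_gt_0_iff_finite)
    ultimately have "card (stabilizer G \<phi> ?x) \<noteq> 0"
      "real (card K) * real (card (stabilizer G \<phi> ?x)) = real (order G)"
      by (metis mult_0_right less_irrefl, metis of_nat_mult)
    then show "real (card K) = real (order G) / real (card (stabilizer G \<psi> ?x))"
      by (simp add: stab_eq[OF xE] field_simps)
  qed
  finally show ?thesis by (simp add: orbits_eq)
qed

section \<open>The coordinate group acts by isometries\<close>

lemma act_one: "act \<one>\<^bsub>coord_group n\<^esub> x = x"
  by (simp add: act_def coord_group_def)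

text \<open>Interchanging \<open>Omega\<close> and \<open>OmegaBar\<close> preserves
  \<open>kdot\<close> and \<open>sqnorm\<close>, and the inverse of \<open>p\<close> merely
  reindexes the sums over coordinates.\<close>

lemma
  assumes g: "g \<in> carrier (coord_group n)"
  shows act_in_Lpow: "x \<in> carrier (Lpow n) \<Longrightarrow> act g x \<in> carrier (Lpow n)"
    and scalar_prod_act: "scalar_prod n (act g x) (act g y) = scalar_prod n x y"
    and ewt_act: "ewt n (act g x) = ewt n x"
proof -
  obtain S p where gSp: "g = (S, p)" by fastforce
  have S: "S \<subseteq> {..<n}" and p: "p permutes {..<n}"
    using g by (auto simp: gSp coord_group_def)
  let ?q = "inv_into UNIV p"
  have q: "?q permutes {..<n}" using p by (rule permutes_inv)
  have [simp]: "kdot (kconj a) (kconj b) = kdot a b" for a b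
    by (cases a; cases b) (simp_all add: kdot_def qform_def)
  have [simp]: "sqnorm (kconj a) = sqnorm a" for a
    by (cases a) simp_all
  \<comment> \<open>Indices from \<open>n\<close> on are fixed by the inverse of \<open>p\<close>
    and lie outside \<open>S\<close>, so the zero padding survives.\<close>
  show "act g x \<in> carrier (Lpow n)" if "x \<in> carrier (Lpow n)"
    using that S permutes_not_in[OF q] by (force simp: carrier_Lpow act_def gSp)
  have "scalar_prod n (act g x) (act g y) = (\<Sum>i<n. kdot (x (?q i)) (y (?q i)))"
    unfolding scalar_prod_def by (rule sum.cong) (auto simp: act_def gSp)
  also have "\<dots> = scalar_prod n x y"
    unfolding scalar_prod_def using sum.permute[OF q, of "\<lambda>i. kdot (x i) (y i)"] by (simp add: o_def)
  finally show "scalar_prod n (act g x) (act g y) = scalar_prod n x y" .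
  have "ewt n (act g x) = (\<Sum>i<n. sqnorm (x (?q i)))"
    unfolding ewt_def by (rule sum.cong) (auto simp: act_def gSp)
  also have "\<dots> = ewt n x"
    unfolding ewt_def using sum.permute[OF q, of "\<lambda>i. sqnorm (x i)"] by (simp add: o_def)
  finally show "ewt n (act g x) = ewt n x" .
qed

text \<open>Maximality is transported by pulling a vector back along the inverse of
  \<open>g\<close>, which preserves products.\<close>

lemma code_act_in_codes:
  assumes g: "g \<in> carrier (coord_group n)" and C: "C \<in> even_self_dual_codes n"
  shows "code_act g C \<in> even_self_dual_codes n"
proof -
  interpret group "coord_group n" by (rule group_coord_group)
  let ?h = "inv\<^bsub>coord_group n\<^esub> g"
  have h: "?h \<in> carrier (coord_group n)" using g by simp
  show ?thesis
    unfolding code_act_def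
  proof (rule even_self_dual_codesI)
    fix x assume xV: "x \<in> carrier (Lpow n)"
      and x: "\<And>y. y \<in> act g ` C \<Longrightarrow> scalar_prod n x y = 0"
    have gh: "act g (act ?h x) = x"
      using act_mult[OF g h, of x] g by (simp add: act_one)
    have "act ?h x \<in> C"
    proof (rule code_maximal[OF C])
      show "act ?h x \<in> carrier (Lpow n)" using h xV by (rule act_in_Lpow)
      show "scalar_prod n (act ?h x) y = 0" if "y \<in> C" for y
        using x[of "act g y"] that scalar_prod_act[OF g, of "act ?h x" y] gh by simp
    qed
    then show "x \<in> act g ` C" using gh by (metis image_eqI)
  qed (use act_in_Lpow[OF g] scalar_prod_act[OF g] ewt_act[OF g] code_subset[OF C]
      code_orth[OF C] code_even[OF C] in auto)
qed

text \<open>The class sum is asserted for every choice of representatives: by orbit-stabilizer each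
  summand is the size of its class, whichever code is chosen.\<close>

theorem theorem4p10:
  fixes n :: nat
  assumes "n \<ge> 1"
  shows "(\<forall>rep. (\<forall>K\<in>code_classes n. rep K \<in> K) \<longrightarrow>
            real (M_e n) = (\<Sum>K\<in>code_classes n. (2 ^ n * fact n) / real (card (Aut n (rep K))))) \<and>
         M_e n = (\<Prod>i = 0..n - 1. (2 ^ i + 1))"
proof (intro conjI allI impI)
  fix rep :: "(nat \<Rightarrow> klein) set set \<Rightarrow> (nat \<Rightarrow> klein) set"
  assume rep: "\<forall>K\<in>code_classes n. rep K \<in> K"
  let ?G = "coord_group n"
  have order: "order ?G = 2 ^ n * fact n"
    by (simp add: order_def card_coord_group)
  have "real (card (even_self_dual_codes n)) =
      (\<Sum>K\<in>orbits ?G (even_self_dual_codes n) code_act.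
        real (order ?G) / real (card (stabilizer ?G code_act (rep K))))"
  proof (rule card_eq_sum_orbits[OF group_coord_group _ finite_even_self_dual_codes])
    \<comment> \<open>An infinite carrier would have \<open>card\<close> 0.\<close>
    show "finite (carrier ?G)"
      by (rule card_ge_0_finite) (simp add: card_coord_group)
    show "code_act (g \<otimes>\<^bsub>?G\<^esub> h) C = code_act g (code_act h C)"
      if "g \<in> carrier ?G" "h \<in> carrier ?G" for g h C
      using that by (simp add: code_act_def act_mult image_image)
    show "code_act \<one>\<^bsub>?G\<^esub> C = C" for C
      by (simp add: code_act_def act_one)
  qed (use rep code_act_in_codes in \<open>auto simp: code_classes_def\<close>)
  then show "real (M_e n) = (\<Sum>K\<in>code_classes n. (2 ^ n * fact n) / real (card (Aut n (rep K))))"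
    by (simp add: M_e_def code_classes_def Aut_def order)
next
  \<comment> \<open>The subtraction is truncated: at \<open>n = 0\<close> the left side would be
    \<open>{0}\<close>, so \<open>n \<ge> 1\<close> matters here.\<close>
  have "{0..n - 1} = {..<n}" using assms by auto
  then show "M_e n = (\<Prod>i = 0..n - 1. (2 ^ i + 1))"
    by (simp add: M_e_def card_even_self_dual_codes)
qed

end
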